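(* Let $\varphi(s,v)=\vec c(s)+v\,\vec q(s)$ be a developable spacelike ruled surface in Minkowski 3-space $\mathbb{R}^3_1$ with striction curve $\vec c$ parametrized by arc length $s$, Frenet frame $\{\vec q,\vec h,\vec a\}$, conical curvature $\kappa$, and $s_1$ the arc length of the spherical image of $\vec q$. Let $R$ be a nonzero constant and let $\varphi^*(s,v)=\vec c^{\,*}(s)+v\,\vec q^{\,*}(s)$ be a developable timelike ruled surface of type $N_+$ or $N_-$ with striction curve $\vec c^{\,*}(s)=\vec c(s)+R\,\vec a(s)$. Then $\varphi^*$ is a Mannheim offset of $\varphi$ if and only if $$\frac{d\kappa}{ds}=\frac1R\left(R^2\kappa^2\left(\frac{ds_1}{ds}\right)^2-1\right)-\frac{1}{ds_1/ds}\,\frac{d^2s_1}{ds^2}\,\kappa .$$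
   Context: Minkowski 3-space $\mathbb{R}^3_1$ is $\mathbb{R}^3$ with the metric $\langle x,y\rangle=-x_1y_1+x_2y_2+x_3y_3$; a vector $x$ is spacelike if $\langle x,x\rangle>0$ or $x=0$, timelike if $\langle x,x\rangle<0$, null if $\langle x,x\rangle=0$ and $x\ne0$; $\|x\|=\sqrt{|\langle x,x\rangle|}$. All curves and functions are smooth on an open interval. Ruled surface: $\varphi(s,v)=\vec c(s)+v\,\vec q(s)$ with $\langle\vec q,\vec q\rangle=\pm1$ and $d\vec q/ds$ non-null and nonzero everywhere. The base curve $\vec c$ is the striction curve if $\langle d\vec c/ds,d\vec q/ds\rangle=0$; this is assumed for all base curves denoted $\vec c,\vec c^{\,*}$. The surface is developable if its distribution parameter $\delta=\det(\vec c\,',\vec q,\vec q\,')/\langle \vec q\,',\vec q\,'\rangle$ vanishes identically. For a developable ruled surface the ruling is tangent to the striction curve; for the developable spacelike surface $\varphi$ the parameter $s$ is the arc length of $\vec c$, oriented so that $d\vec c/ds=\vec q$. Frenet frame: $\vec q$ is the ruling, $\vec h=\frac{d\vec q/ds}{\|d\vec q/ds\|}$ the central normal vector, and $\vec a$ the asymptotic normal vector, i.e. the unit vector orthogonal to $\vec q$ and $\vec h$ (in the direction of $\pm\,\vec q\times\vec h$). The central normal and the asymptotic normal of a ruling are the lines through the striction point $\vec c(s)$ with directions $\vec h(s)$ and $\vec a(s)$, respectively. Types: the surface is of type $N_-$ if $\vec h$ is spacelike and $\vec q$ is timelike (so $\vec a$ is spacelike); of type $N_+$ if $\vec h$ and $\vec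 q$ are both spacelike (so $\vec a$ is timelike). Both are timelike surfaces. A spacelike ruled surface here means one of type $N_\times$: $\vec h$ is timelike and $\vec q$ is spacelike (so $\vec a$ is spacelike). For a spacelike ruled surface (type $N_\times$), $s_1$ denotes the arc length of the spherical curve $\vec q(s)$, so $ds_1/ds=\|d\vec q/ds\|$, and the conical curvature $\kappa$ is defined by the Frenet formulas $d\vec q/ds_1=\vec h$, $d\vec h/ds_1=\vec q+\kappa\vec a$, $d\vec a/ds_1=\kappa\vec h$. Mannheim offset: a ruled surface $\varphi^*$ with striction curve $\vec c^{\,*}$ and Frenet frame $\{\vec q^{\,*},\vec h^*,\vec a^*\}$ is a Mannheim offset of the spacelike ruled surface $\varphi$ if there is a one-to-one correspondence between their rulings (same parameter $s$) such that the asymptotic normal of $\varphi$ is the central normal of $\varphi^*$ (the two lines coincide, i.e. $\vec h^*=\pm\vec a$ and $\vec c^{\,*}-\vec c$ is a multiple of $\vec a$; orientations may be chosen so that $\vec h^*=\vec a$). *)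

theory Defs
  imports "HOL-Analysis.Analysis"
begin

definition mink :: "real^3 \<Rightarrow> real^3 \<Rightarrow> real" where
  "mink x y = - (x$1 * y$1) + x$2 * y$2 + x$3 * y$3"

definition mnorm :: "real^3 \<Rightarrow> real" where
  "mnorm x = sqrt \<bar>mink x x\<bar>"

definition spacelike :: "real^3 \<Rightarrow> bool" where
  "spacelike x \<longleftrightarrow> mink x x > 0 \<or> x = 0"

definition timelike :: "real^3 \<Rightarrow> bool" where
  "timelike x \<longleftrightarrow> mink x x < 0"

definition null_vector :: "real^3 \<Rightarrow> bool" where
  "null_vector x \<longleftrightarrow> mink x x = 0 \<and> x \<noteq> 0"

abbreviation velocity :: "(real \<Rightarrow> 'a::real_normed_vector) \<Rightarrow> real \<Rightarrow> 'a" where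
  "velocity f \<equiv> (\<lambda>s. vector_derivative f (at s))"

text \<open>Infinite differentiability; meant for open \<open>I\<close>, where the iterated derivatives at points
  of \<open>I\<close> depend only on the values of \<open>f\<close> on \<open>I\<close>.\<close>

definition smooth_on :: "real set \<Rightarrow> (real \<Rightarrow> 'a::real_normed_vector) \<Rightarrow> bool" where
  "smooth_on I f \<longleftrightarrow> (\<forall>n. \<forall>s\<in>I. (velocity ^^ n) f differentiable (at s))"

text \<open>The base curve of a ruled surface is always taken to be its striction curve; this is a
  separate condition, \<open>striction_curve\<close>.\<close>

definition ruled_surface ::
  "real set \<Rightarrow> (real \<Rightarrow> real \<Rightarrow> real^3) \<Rightarrow> (real \<Rightarrow> real^3) \<Rightarrow> (real \<Rightarrow> real^3) \<Rightarrow> bool" where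
  "ruled_surface I \<phi> c q \<longleftrightarrow>
     smooth_on I c \<and> smooth_on I q \<and>
     (\<forall>s\<in>I. \<forall>v. \<phi> s v = c s + v *\<^sub>R q s) \<and>
     ((\<forall>s\<in>I. mink (q s) (q s) = 1) \<or> (\<forall>s\<in>I. mink (q s) (q s) = -1)) \<and>
     (\<forall>s\<in>I. velocity q s \<noteq> 0 \<and> \<not> null_vector (velocity q s))"

definition striction_curve :: "real set \<Rightarrow> (real \<Rightarrow> real^3) \<Rightarrow> (real \<Rightarrow> real^3) \<Rightarrow> bool" where
  "striction_curve I c q \<longleftrightarrow> (\<forall>s\<in>I. mink (velocity c s) (velocity q s) = 0)"

definition distribution_parameter ::
  "(real \<Rightarrow> real^3) \<Rightarrow> (real \<Rightarrow> real^3) \<Rightarrow> real \<Rightarrow> real" where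
  "distribution_parameter c q s =
     det (vector [velocity c s, q s, velocity q s] :: real^3^3)
       / mink (velocity q s) (velocity q s)"

definition developable :: "real set \<Rightarrow> (real \<Rightarrow> real^3) \<Rightarrow> (real \<Rightarrow> real^3) \<Rightarrow> bool" where
  "developable I c q \<longleftrightarrow> (\<forall>s\<in>I. distribution_parameter c q s = 0)"

text \<open>The conditions on \<open>a\<close> determine it up to a global sign on an interval, that is, they amount
  to \<open>a\<close> being one of the two unit fields in the direction of the cross product of \<open>q\<close> and \<open>h\<close>.\<close>

definition frenet_frame ::
  "real set \<Rightarrow> (real \<Rightarrow> real^3) \<Rightarrow> (real \<Rightarrow> real^3) \<Rightarrow> (real \<Rightarrow> real^3) \<Rightarrow> bool" where
  "frenet_frame I q h a \<longleftrightarrow>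
     smooth_on I h \<and> smooth_on I a \<and>
     (\<forall>s\<in>I. h s = (1 / mnorm (velocity q s)) *\<^sub>R velocity q s \<and>
             mnorm (a s) = 1 \<and> mink (a s) (q s) = 0 \<and> mink (a s) (h s) = 0)"

definition type_N_minus :: "real set \<Rightarrow> (real \<Rightarrow> real^3) \<Rightarrow> (real \<Rightarrow> real^3) \<Rightarrow> bool" where
  "type_N_minus I q h \<longleftrightarrow> (\<forall>s\<in>I. spacelike (h s) \<and> timelike (q s))"

definition type_N_plus :: "real set \<Rightarrow> (real \<Rightarrow> real^3) \<Rightarrow> (real \<Rightarrow> real^3) \<Rightarrow> bool" where
  "type_N_plus I q h \<longleftrightarrow> (\<forall>s\<in>I. spacelike (h s) \<and> spacelike (q s))"

text \<open>The spacelike ruled surfaces.\<close>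

definition type_N_times :: "real set \<Rightarrow> (real \<Rightarrow> real^3) \<Rightarrow> (real \<Rightarrow> real^3) \<Rightarrow> bool" where
  "type_N_times I q h \<longleftrightarrow> (\<forall>s\<in>I. timelike (h s) \<and> spacelike (q s))"

definition arc_length_parametrized :: "real set \<Rightarrow> (real \<Rightarrow> real^3) \<Rightarrow> bool" where
  "arc_length_parametrized I c \<longleftrightarrow> (\<forall>s\<in>I. mnorm (velocity c s) = 1)"

definition arc_length_function :: "real set \<Rightarrow> (real \<Rightarrow> real^3) \<Rightarrow> (real \<Rightarrow> real) \<Rightarrow> bool" where
  "arc_length_function I q s1 \<longleftrightarrow>
     smooth_on I s1 \<and> (\<forall>s\<in>I. (s1 has_real_derivative mnorm (velocity q s)) (at s))"

text \<open>The derivative of \<open>f\<close> with respect to \<open>s1\<close>, both being functions of the parameter \<open>s\<close>.\<close>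

definition deriv_wrt :: "(real \<Rightarrow> real) \<Rightarrow> (real \<Rightarrow> real^3) \<Rightarrow> real \<Rightarrow> real^3" where
  "deriv_wrt s1 f s = (1 / deriv s1 s) *\<^sub>R velocity f s"

text \<open>The conical curvature is the coefficient function in the Frenet formulas of a surface of
  type \<open>N_times\<close>.\<close>

definition conical_curvature ::
  "real set \<Rightarrow> (real \<Rightarrow> real) \<Rightarrow> (real \<Rightarrow> real^3) \<Rightarrow> (real \<Rightarrow> real^3) \<Rightarrow> (real \<Rightarrow> real^3) \<Rightarrow>
   (real \<Rightarrow> real) \<Rightarrow> bool" where
  "conical_curvature I s1 q h a \<kappa> \<longleftrightarrow>
     smooth_on I \<kappa> \<and>
     (\<forall>s\<in>I. deriv_wrt s1 q s = h s \<and>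
             deriv_wrt s1 h s = q s + \<kappa> s *\<^sub>R a s \<and>
             deriv_wrt s1 a s = \<kappa> s *\<^sub>R h s)"

definition line_through :: "real^3 \<Rightarrow> real^3 \<Rightarrow> (real^3) set" where
  "line_through p d = range (\<lambda>t. p + t *\<^sub>R d)"

definition central_normal :: "(real \<Rightarrow> real^3) \<Rightarrow> (real \<Rightarrow> real^3) \<Rightarrow> real \<Rightarrow> (real^3) set" where
  "central_normal c h s = line_through (c s) (h s)"

definition asymptotic_normal :: "(real \<Rightarrow> real^3) \<Rightarrow> (real \<Rightarrow> real^3) \<Rightarrow> real \<Rightarrow> (real^3) set" where
  "asymptotic_normal c a s = line_through (c s) (a s)"

text \<open>Rulings of the two surfaces correspond when they have the same parameter. The arguments are
  the striction curve and the asymptotic normal vector of the given surface, and the striction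
  curve and the central normal vector of the offset.\<close>

definition mannheim_offset ::
  "real set \<Rightarrow> (real \<Rightarrow> real^3) \<Rightarrow> (real \<Rightarrow> real^3) \<Rightarrow> (real \<Rightarrow> real^3) \<Rightarrow> (real \<Rightarrow> real^3) \<Rightarrow> bool" where
  "mannheim_offset I c a c' h' \<longleftrightarrow>
     (\<forall>s\<in>I. asymptotic_normal c a s = central_normal c' h' s)"

end

theory Submission
  imports Defs
begin

text \<open>
  Write \<open>\<sigma> = ds1/ds\<close>, \<open>f = R \<kappa> \<sigma>\<close>, and a dash for \<open>d/ds\<close> in the formulas below. By the Frenet
  formula for \<open>a\<close>, the curve \<open>c + R a\<close> has velocity \<open>T = q + f h\<close>
  (\<open>asymptotic_offset_velocity\<close>), and the other two Frenet formulas give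
  \<open>T' = f \<sigma> q + (\<sigma> + f') h + f \<sigma> \<kappa> a\<close>.

  Call the offset ruling \<open>u\<close>. Since the offset surface is developable, \<open>T = l u\<close>
  (\<open>developable_velocity_along_ruling\<close>), with \<open>l\<close> never zero because \<open>q\<close> and \<open>h\<close> are independent;
  hence \<open>T' = l' u + l u'\<close>, where \<open>u'\<close> is orthogonal to \<open>u\<close>. The curve \<open>c + R a\<close> meets the
  asymptotic normals by construction, so being a Mannheim offset means exactly that \<open>u'\<close> is
  everywhere parallel to \<open>a\<close> (\<open>mannheim_offset_iff_ruling_velocity\<close>).

  Modulo \<open>a\<close>, the vector \<open>T'\<close> must then be a multiple of \<open>T\<close>. Comparing coefficients in
  \<open>q\<close> and \<open>h\<close>, this is \<open>\<sigma> + f' = f (f \<sigma>)\<close>. Conversely, this equation forces \<open>u'\<close> to be parallel to \<open>a\<close>,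
  since both are orthogonal to the non-null vector \<open>u\<close>
  (\<open>ruling_velocity_along_asymptotic_normal_iff\<close>). Dividing \<open>R (\<kappa>' \<sigma> + \<kappa> \<sigma>') = \<sigma> (f^2 - 1)\<close> by
  \<open>R \<sigma>\<close> turns it into the stated differential equation for \<open>\<kappa>\<close>.
\<close>

section \<open>The Minkowski product\<close>

lemma bounded_bilinear_mink: "bounded_bilinear mink"
  by (auto simp: bilinear_conv_bounded_bilinear[symmetric] bilinear_def mink_def algebra_simps
      intro!: linearI)

interpretation mink: bounded_bilinear mink
  by (rule bounded_bilinear_mink)

lemmas mink_bilinear = mink.add_left mink.add_right mink.scaleR_left mink.scaleR_right

lemma mink_commute: "mink x y = mink y x"
  by (simp add: mink_def mult.commute)

lemma has_real_derivative_mink: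
  assumes "(f has_vector_derivative f') (at s)" "(g has_vector_derivative g') (at s)"
  shows "((\<lambda>t. mink (f t) (g t)) has_real_derivative mink f' (g s) + mink (f s) g') (at s)"
  using mink.has_vector_derivative[OF assms]
  by (simp add: has_real_derivative_iff_has_vector_derivative add.commute)

lemma mnorm_pos_iff: "mnorm x > 0 \<longleftrightarrow> x \<noteq> 0 \<and> \<not> null_vector x"
  by (auto simp: mnorm_def null_vector_def mink_def)

lemma mink_normalize:
  assumes "mink x x \<noteq> 0"
  shows "mink ((1 / mnorm x) *\<^sub>R x) ((1 / mnorm x) *\<^sub>R x) = sgn (mink x x)"
  using assms by (simp add: mink_bilinear mnorm_def sgn_if)

lemma mink_unit_velocity:
  assumes "open I" "s \<in> I" "q differentiable (at s)" "\<And>t. t \<in> I \<Longrightarrow> mink (q t) (q t) = e"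
  shows "mink (q s) (velocity q s) = 0"
proof -
  have "(q has_vector_derivative velocity q s) (at s)"
    using assms(3) by (simp add: vector_derivative_works)
  note D = has_real_derivative_mink[OF this this]
  have "((\<lambda>t. mink (q t) (q t)) has_real_derivative 0) (at s)"
    by (rule DERIV_const[THEN has_field_derivative_transform_within_open, OF assms(1,2)])
       (simp add: assms(4))
  from DERIV_unique[OF D this] show ?thesis
    by (simp add: mink_commute)
qed

text \<open>Because \<open>u\<close> and \<open>w\<close> are non-null and orthogonal, the plane they span is non-degenerate;
  the determinant puts \<open>x\<close> into it, and orthogonality to \<open>w\<close> leaves only the \<open>u\<close>-component. This
  is why the velocity of the striction curve of a developable surface points along the ruling.\<close>

lemma collinear_if_det_zero_orthogonal:
  fixes x u w :: "real^3"
  assumes "mink u u \<noteq> 0" "mink w w \<noteq> 0" "mink u w = 0" "mink x w = 0"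
    and "det (vector [x, u, w] :: real^3^3) = 0"
  shows "x = (mink x u / mink u u) *\<^sub>R u"
proof -
  define y where "y = mink u u *\<^sub>R x - mink x u *\<^sub>R u"
  have yu: "mink y u = 0" and yw: "mink y w = 0"
    using assms(3,4) by (simp_all add: y_def mink.diff_left mink_bilinear)
  have "det (vector [y, u, w] :: real^3^3) = mink u u * det (vector [x, u, w] :: real^3^3)"
    by (simp add: det_3 y_def algebra_simps)
  then have yd: "det (vector [y, u, w] :: real^3^3) = 0"
    using assms(5) by simp
  \<comment> \<open>With \<open>n\<close> the Euclidean cross product of \<open>u\<close> and \<open>w\<close>, orthogonality to \<open>u\<close> and \<open>w\<close> makes
    \<open>(- y1, y2, y3)\<close> a multiple of \<open>n\<close>, and \<open>yd\<close> says that the Euclidean product of \<open>y\<close> and \<open>n\<close> is zero;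
    so \<open>mink n n = - (mink u u * mink w w)\<close> annihilates every component of \<open>y\<close>.\<close>
  have "mink u u * mink w w * y $ 1 = 0" "mink u u * mink w w * y $ 2 = 0"
    "mink u u * mink w w * y $ 3 = 0"
    using yu yw assms(3) yd unfolding mink_def det_3 vector_3 by algebra+
  then have "y = 0"
    using assms(1,2) by (simp add: vec_eq_iff forall_3)
  then show ?thesis
    using assms(1) by (simp add: y_def eq_vector_fraction_iff)
qed

section \<open>Ruled surfaces and their frames\<close>

lemma smooth_on_differentiable:
  assumes "smooth_on I f" "s \<in> I"
  shows "f differentiable (at s)" "velocity f differentiable (at s)"
  using assms(1)[unfolded smooth_on_def, rule_format, of s 0]
    assms(1)[unfolded smooth_on_def, rule_format, of s 1] assms(2) by simp_all

lemma smooth_on_has_velocity: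
  assumes "smooth_on I f" "s \<in> I"
  shows "(f has_vector_derivative velocity f s) (at s)"
    and "(velocity f has_vector_derivative velocity (velocity f) s) (at s)"
  using smooth_on_differentiable[OF assms] by (simp_all add: vector_derivative_works)

lemma ruled_surface_ruling_square:
  assumes "ruled_surface I \<phi> c q"
  obtains e where "\<And>t. t \<in> I \<Longrightarrow> mink (q t) (q t) = e" "e = 1 \<or> e = - 1"
proof -
  from assms have "(\<forall>s\<in>I. mink (q s) (q s) = 1) \<or> (\<forall>s\<in>I. mink (q s) (q s) = - 1)"
    by (simp add: ruled_surface_def)
  then show thesis
    using that[of 1] that[of "- 1"] by blast
qed

lemma spacelike_surface_frame:
  assumes "open I" "s \<in> I" "ruled_surface I \<phi> c q" "frenet_frame I q h a" "type_N_times I q h"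
  shows "mink (q s) (q s) = 1" "mink (h s) (h s) = - 1" "mink (q s) (h s) = 0"
    and "mink (a s) (q s) = 0" "mink (a s) (h s) = 0"
proof -
  have h: "h s = (1 / mnorm (velocity q s)) *\<^sub>R velocity q s"
    using assms by (simp add: frenet_frame_def)
  have hneg: "mink (h s) (h s) < 0"
    using assms by (simp add: type_N_times_def timelike_def)
  then have "mink (velocity q s) (velocity q s) \<noteq> 0"
    by (auto simp: h mink_bilinear)
  then show "mink (h s) (h s) = - 1"
    using mink_normalize[of "velocity q s"] hneg by (auto simp: h sgn_if split: if_splits)
  obtain e where e: "\<And>t. t \<in> I \<Longrightarrow> mink (q t) (q t) = e" "e = 1 \<or> e = - 1"
    using ruled_surface_ruling_square[OF assms(3)] by blast
  have "mink (q s) (q s) > 0 \<or> q s = 0"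
    using assms by (simp add: type_N_times_def spacelike_def)
  then show "mink (q s) (q s) = 1"
    using e(1)[OF assms(2)] e(2) by (auto simp: mink.zero_left)
  have "q differentiable (at s)"
    using assms smooth_on_differentiable by (auto simp: ruled_surface_def)
  from mink_unit_velocity[OF assms(1,2) this e(1)] show "mink (q s) (h s) = 0"
    by (simp add: h mink_bilinear)
  show "mink (a s) (q s) = 0" "mink (a s) (h s) = 0"
    using assms(2,4) unfolding frenet_frame_def by blast+
qed

lemma developable_velocity_along_ruling:
  assumes "open I" "s \<in> I" "ruled_surface I \<phi> c q" "striction_curve I c q" "developable I c q"
  shows "mink (q s) (q s) \<noteq> 0" "mink (q s) (velocity q s) = 0"
    and "velocity c s = (mink (velocity c s) (q s) / mink (q s) (q s)) *\<^sub>R q s"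
proof -
  obtain e where e: "\<And>t. t \<in> I \<Longrightarrow> mink (q t) (q t) = e" "e = 1 \<or> e = - 1"
    using ruled_surface_ruling_square[OF assms(3)] by blast
  show ne: "mink (q s) (q s) \<noteq> 0"
    using e assms(2) by auto
  have "q differentiable (at s)"
    using assms smooth_on_differentiable by (auto simp: ruled_surface_def)
  from mink_unit_velocity[OF assms(1,2) this e(1)] show orth: "mink (q s) (velocity q s) = 0" .
  have w: "mink (velocity q s) (velocity q s) \<noteq> 0"
    using assms(2,3) by (auto simp: ruled_surface_def null_vector_def)
  show "velocity c s = (mink (velocity c s) (q s) / mink (q s) (q s)) *\<^sub>R q s"
    using assms(2,4,5) w
    by (intro collinear_if_det_zero_orthogonal[OF ne w orth])
       (auto simp: striction_curve_def developable_def distribution_parameter_def)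
qed

text \<open>The factor \<open>l\<close> with \<open>velocity c = l q\<close> is itself differentiable, because it can be recovered from
  \<open>velocity c\<close> and \<open>q\<close> as a quotient of Minkowski products with constant denominator.\<close>

lemma developable_acceleration:
  assumes "open I" "s \<in> I" "ruled_surface I \<phi> c q" "striction_curve I c q" "developable I c q"
  obtains l m where "velocity c s = l *\<^sub>R q s"
    "velocity (velocity c) s = m *\<^sub>R q s + l *\<^sub>R velocity q s"
proof -
  note along = developable_velocity_along_ruling[OF assms(1) _ assms(3-5)]
  obtain e where e: "\<And>t. t \<in> I \<Longrightarrow> mink (q t) (q t) = e"
    using ruled_surface_ruling_square[OF assms(3)] by blast
  define l where "l t = mink (velocity c t) (q t) / e" for t
  have T: "velocity c t = l t *\<^sub>R q t" if "t \<in> I" for t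
    using along(3)[OF that] e[OF that] by (simp add: l_def)
  have Dq: "(q has_vector_derivative velocity q s) (at s)"
    and Dc: "(velocity c has_vector_derivative velocity (velocity c) s) (at s)"
    using assms(2,3) smooth_on_has_velocity by (auto simp: ruled_surface_def)
  obtain m where "(l has_real_derivative m) (at s)"
    using DERIV_cdivide[OF has_real_derivative_mink[OF Dc Dq], of e] unfolding l_def by blast
  from has_vector_derivative_scaleR[OF this Dq]
  have "(velocity c has_vector_derivative l s *\<^sub>R velocity q s + m *\<^sub>R q s) (at s)"
    by (rule has_vector_derivative_transform_within_open[OF _ assms(1,2)]) (simp add: T)
  from vector_derivative_at[OF this] that[OF T[OF assms(2)], of m] show thesis
    by (simp add: add.commute)
qed

section \<open>Coincidence of normal lines\<close>

lemma line_through_eq_iff: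
  assumes "d' \<noteq> 0"
  shows "line_through p d = line_through (p + r *\<^sub>R d) d' \<longleftrightarrow> (\<exists>k. d' = k *\<^sub>R d)"
proof
  assume eq: "line_through p d = line_through (p + r *\<^sub>R d) d'"
  have "p + r *\<^sub>R d + 1 *\<^sub>R d' \<in> line_through (p + r *\<^sub>R d) d'"
    unfolding line_through_def by blast
  then obtain t where "p + r *\<^sub>R d + 1 *\<^sub>R d' = p + t *\<^sub>R d"
    unfolding eq[symmetric] unfolding line_through_def by (rule rangeE)
  then have "d' = (t - r) *\<^sub>R d"
    by (simp add: algebra_simps)
  then show "\<exists>k. d' = k *\<^sub>R d" ..
next
  assume "\<exists>k. d' = k *\<^sub>R d"
  then obtain k where k: "d' = k *\<^sub>R d" "k \<noteq> 0"
    using assms by auto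
  show "line_through p d = line_through (p + r *\<^sub>R d) d'"
    unfolding line_through_def
  proof (intro equalityI image_subsetI)
    fix t
    have "((t - r) / k) *\<^sub>R d' = (t - r) *\<^sub>R d"
      using k by simp
    then show "p + t *\<^sub>R d \<in> range (\<lambda>t. p + r *\<^sub>R d + t *\<^sub>R d')"
      by (intro range_eqI[of _ _ "(t - r) / k"]) (simp add: algebra_simps)
  next
    fix t
    show "p + r *\<^sub>R d + t *\<^sub>R d' \<in> range (\<lambda>t. p + t *\<^sub>R d)"
      by (intro range_eqI[of _ _ "r + t * k"]) (simp add: k algebra_simps)
  qed
qed

text \<open>As \<open>c'\<close> lies on the asymptotic normals of the given surface, only the directions of the two
  lines matter, and the direction of the central normal is that of \<open>velocity q'\<close>.\<close>

lemma mannheim_offset_iff_ruling_velocity: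
  assumes "ruled_surface I \<phi> c' q'" "frenet_frame I q' h' a'"
    and "\<And>s. s \<in> I \<Longrightarrow> c' s = c s + R *\<^sub>R a s"
  shows "mannheim_offset I c a c' h' \<longleftrightarrow> (\<forall>s\<in>I. \<exists>k. velocity q' s = k *\<^sub>R a s)"
  unfolding mannheim_offset_def
proof (intro ball_cong refl)
  fix s assume s: "s \<in> I"
  define n where "n = mnorm (velocity q' s)"
  have n: "n > 0"
    using assms(1) s by (auto simp: ruled_surface_def n_def mnorm_pos_iff)
  have h': "h' s = (1 / n) *\<^sub>R velocity q' s"
    using assms(2) s by (simp add: frenet_frame_def n_def)
  have v: "velocity q' s = n *\<^sub>R h' s"
    using n by (simp add: h')
  have "h' s \<noteq> 0"
    using assms(1) s n by (simp add: h' ruled_surface_def)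
  then have "asymptotic_normal c a s = central_normal c' h' s \<longleftrightarrow> (\<exists>k. h' s = k *\<^sub>R a s)"
    unfolding asymptotic_normal_def central_normal_def assms(3)[OF s]
    by (rule line_through_eq_iff)
  also have "\<dots> \<longleftrightarrow> (\<exists>k. velocity q' s = k *\<^sub>R a s)"
  proof
    assume "\<exists>k. h' s = k *\<^sub>R a s"
    then show "\<exists>k. velocity q' s = k *\<^sub>R a s"
      unfolding v by (metis scaleR_scaleR)
  next
    assume "\<exists>k. velocity q' s = k *\<^sub>R a s"
    then show "\<exists>k. h' s = k *\<^sub>R a s"
      unfolding h' by (metis scaleR_scaleR)
  qed
  finally show "asymptotic_normal c a s = central_normal c' h' s \<longleftrightarrow>
    (\<exists>k. velocity q' s = k *\<^sub>R a s)" .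
qed

section \<open>The offset in the frame of the original surface\<close>

text \<open>Here \<open>T = l u\<close> is the velocity of the offset's striction curve, \<open>u\<close> its ruling, \<open>w\<close> the derivative
  of \<open>u\<close>, and \<open>acc\<close> expresses the derivative of \<open>T\<close> in two ways. If \<open>w\<close> is a multiple of \<open>a\<close>, the
  derivative of \<open>T\<close> lies in the span of \<open>T = q + f h\<close> and \<open>a\<close>, so its \<open>q\<close>- and \<open>h\<close>-coefficients are in
  the ratio \<open>1 : f\<close>. Conversely, this ratio makes \<open>m u + l w\<close> a combination of \<open>u\<close> and \<open>a\<close>; both \<open>w\<close> and \<open>a\<close>
  are orthogonal to the non-null \<open>u\<close>, so the \<open>u\<close>-components agree and \<open>w\<close> is left as a multiple
  of \<open>a\<close>.\<close>

lemma ruling_velocity_along_asymptotic_normal_iff: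
  fixes q h a u w :: "real^3"
  assumes frame: "mink q q = 1" "mink h h = - 1" "mink q h = 0" "mink a q = 0" "mink a h = 0"
    and u: "mink u u \<noteq> 0" "mink u w = 0"
    and T: "l *\<^sub>R u = q + f *\<^sub>R h"
    and acc: "m *\<^sub>R u + l *\<^sub>R w = x *\<^sub>R q + y *\<^sub>R h + z *\<^sub>R a"
  shows "(\<exists>k. w = k *\<^sub>R a) \<longleftrightarrow> y = f * x"
proof -
  have frame': "mink h q = 0" "mink q a = 0" "mink h a = 0"
    using frame(3-5) by (simp_all add: mink_commute)
  have "mink (l *\<^sub>R u) q = 1"
    by (simp add: T mink_bilinear frame frame')
  then have l: "l \<noteq> 0"
    by (auto simp: mink.zero_left)
  have ind: "x = 0 \<and> y = 0" if "x *\<^sub>R q + y *\<^sub>R h + z *\<^sub>R a = 0" for x y z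
    using arg_cong[OF that, of "\<lambda>v. mink v q"] arg_cong[OF that, of "\<lambda>v. mink v h"]
    by (simp add: mink_bilinear mink.zero_left frame frame')
  have "m *\<^sub>R (l *\<^sub>R u) + (l * l) *\<^sub>R w = l *\<^sub>R (m *\<^sub>R u + l *\<^sub>R w)"
    by (simp add: algebra_simps)
  then have split: "m *\<^sub>R (q + f *\<^sub>R h) + (l * l) *\<^sub>R w = l *\<^sub>R (x *\<^sub>R q + y *\<^sub>R h + z *\<^sub>R a)"
    by (simp only: T acc)
  show ?thesis
  proof
    assume "\<exists>k. w = k *\<^sub>R a"
    then obtain k where "w = k *\<^sub>R a" ..
    with split have "(m - l * x) *\<^sub>R q + (m * f - l * y) *\<^sub>R h + (l * l * k - l * z) *\<^sub>R a = 0"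
      by (simp add: algebra_simps)
    from ind[OF this] have "l * y = l * (f * x)"
      by algebra
    then show "y = f * x"
      using l by simp
  next
    assume "y = f * x"
    then have "m *\<^sub>R u + l *\<^sub>R w = x *\<^sub>R (q + f *\<^sub>R h) + z *\<^sub>R a"
      unfolding acc by (simp add: algebra_simps)
    then have xu: "m *\<^sub>R u + l *\<^sub>R w = (x * l) *\<^sub>R u + z *\<^sub>R a"
      by (simp flip: T)
    have "mink (l *\<^sub>R u) a = 0"
      by (simp add: T mink_bilinear frame frame')
    then have ua: "mink u a = 0"
      using l by (simp add: mink_bilinear)
    have "m = x * l"
      using arg_cong[OF xu, of "mink u"] u by (simp add: mink_bilinear ua)
    with xu have "l *\<^sub>R w = z *\<^sub>R a"
      by simp
    then have "w = (z / l) *\<^sub>R a"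
      using l by (metis divide_inverse_commute left_inverse scaleR_one scaleR_scaleR)
    then show "\<exists>k. w = k *\<^sub>R a" ..
  qed
qed

lemma asymptotic_offset_velocity:
  assumes "open I" "s \<in> I" "frenet_frame I q h a"
    and "conical_curvature I s1 q h a \<kappa>" "deriv s1 s > 0"
    and c: "smooth_on I c" "velocity c s = q s"
    and c': "\<And>s. s \<in> I \<Longrightarrow> c' s = c s + R *\<^sub>R a s"
  shows "velocity c' s = q s + (R * \<kappa> s * deriv s1 s) *\<^sub>R h s"
proof -
  have "velocity a s = (\<kappa> s * deriv s1 s) *\<^sub>R h s"
  proof -
    have "(1 / deriv s1 s) *\<^sub>R velocity a s = \<kappa> s *\<^sub>R h s"
      using assms(2,4) by (simp add: conical_curvature_def deriv_wrt_def)
    from arg_cong[OF this, of "\<lambda>v. deriv s1 s *\<^sub>R v"] show ?thesis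
      using assms(5) by (simp add: mult.commute)
  qed
  moreover have "((\<lambda>t. c t + R *\<^sub>R a t) has_vector_derivative velocity c s + R *\<^sub>R velocity a s) (at s)"
    using assms(2,3) c(1)
    by (intro has_vector_derivative_add smooth_on_has_velocity(1)
        bounded_linear.has_vector_derivative[OF bounded_linear_scaleR_right])
       (auto simp: frenet_frame_def)
  then have "(c' has_vector_derivative velocity c s + R *\<^sub>R velocity a s) (at s)"
    by (rule has_vector_derivative_transform_within_open[OF _ assms(1,2)]) (simp add: c')
  ultimately show ?thesis
    using c(2) by (simp add: vector_derivative_at mult.assoc)
qed

theorem theorem5p2:
  fixes I :: "real set"
    and \<phi> \<phi>' :: "real \<Rightarrow> real \<Rightarrow> real^3"
    and c q h a c' q' h' a' :: "real \<Rightarrow> real^3"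
    and s1 \<kappa> :: "real \<Rightarrow> real"
    and R :: real
  assumes "open I" and "is_interval I" and "I \<noteq> {}"
    and "ruled_surface I \<phi> c q" and "striction_curve I c q" and "developable I c q"
    and "frenet_frame I q h a" and "type_N_times I q h"
    and "arc_length_parametrized I c" and "\<And>s. s \<in> I \<Longrightarrow> velocity c s = q s"
    and "arc_length_function I q s1" and "conical_curvature I s1 q h a \<kappa>"
    and "R \<noteq> 0"
    and "ruled_surface I \<phi>' c' q'" and "striction_curve I c' q'" and "developable I c' q'"
    and "frenet_frame I q' h' a'" and "type_N_plus I q' h' \<or> type_N_minus I q' h'"
    and "\<And>s. s \<in> I \<Longrightarrow> c' s = c s + R *\<^sub>R a s"
  shows "mannheim_offset I c a c' h' \<longleftrightarrow>
    (\<forall>s\<in>I. deriv \<kappa> s =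
       1 / R * (R\<^sup>2 * (\<kappa> s)\<^sup>2 * (deriv s1 s)\<^sup>2 - 1)
       - 1 / deriv s1 s * deriv (deriv s1) s * \<kappa> s)"
proof (subst mannheim_offset_iff_ruling_velocity[OF assms(14,17)], fact assms(19),
    intro ball_cong refl)
  fix s assume s: "s \<in> I"
  define \<sigma> where "\<sigma> = deriv s1"
  have \<sigma>_pos: "\<sigma> t > 0" if "t \<in> I" for t
  proof -
    have "\<sigma> t = mnorm (velocity q t)"
      using assms(11) that by (auto simp: \<sigma>_def arc_length_function_def intro: DERIV_imp_deriv)
    then show ?thesis
      using assms(4) that by (simp add: ruled_surface_def mnorm_pos_iff)
  qed
  have smooth: "smooth_on I c" "smooth_on I q" "smooth_on I h" "smooth_on I \<kappa>" "smooth_on I s1"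
    using assms(4,7,11,12)
    by (auto simp: ruled_surface_def frenet_frame_def conical_curvature_def arc_length_function_def)
  have T: "velocity c' t = q t + (R * \<kappa> t * \<sigma> t) *\<^sub>R h t" if "t \<in> I" for t
    unfolding \<sigma>_def
    using asymptotic_offset_velocity[OF assms(1) that assms(7,12)] \<sigma>_pos[OF that]
      smooth(1) assms(10)[OF that] assms(19) by (simp add: \<sigma>_def)
  have q': "velocity q s = \<sigma> s *\<^sub>R h s" and h': "velocity h s = \<sigma> s *\<^sub>R (q s + \<kappa> s *\<^sub>R a s)"
  proof -
    have "h s = (1 / \<sigma> s) *\<^sub>R velocity q s" "q s + \<kappa> s *\<^sub>R a s = (1 / \<sigma> s) *\<^sub>R velocity h s"
      using assms(12) s by (simp_all add: conical_curvature_def deriv_wrt_def \<sigma>_def)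
    then show "velocity q s = \<sigma> s *\<^sub>R h s" "velocity h s = \<sigma> s *\<^sub>R (q s + \<kappa> s *\<^sub>R a s)"
      using \<sigma>_pos[OF s] by simp_all
  qed
  define f where "f t = R * \<kappa> t * \<sigma> t" for t
  define g where "g = R * (deriv \<kappa> s * \<sigma> s + \<kappa> s * deriv \<sigma> s)"
  have Df: "(f has_real_derivative g) (at s)"
  proof -
    have "(\<kappa> has_real_derivative deriv \<kappa> s) (at s)"
      using smooth_on_has_velocity(1)[OF smooth(4) s]
      by (simp add: has_real_derivative_iff_has_vector_derivative field_derivative_eq_vector_derivative)
    moreover have "(\<sigma> has_real_derivative deriv \<sigma> s) (at s)"
      using smooth_on_has_velocity(2)[OF smooth(5) s]
      by (simp add: \<sigma>_def has_real_derivative_iff_has_vector_derivative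
          flip: field_derivative_eq_vector_derivative)
    ultimately show ?thesis
      unfolding f_def g_def by (auto intro!: derivative_eq_intros simp: algebra_simps)
  qed
  have "((\<lambda>t. q t + f t *\<^sub>R h t) has_vector_derivative
      velocity q s + (f s *\<^sub>R velocity h s + g *\<^sub>R h s)) (at s)"
    by (intro has_vector_derivative_add has_vector_derivative_scaleR Df
        smooth_on_has_velocity(1)[OF _ s] smooth)
  then have "(velocity c' has_vector_derivative
      velocity q s + (f s *\<^sub>R velocity h s + g *\<^sub>R h s)) (at s)"
    by (rule has_vector_derivative_transform_within_open[OF _ assms(1) s]) (simp add: T f_def)
  from vector_derivative_at[OF this]
  have acc: "velocity (velocity c') s =
      (f s * \<sigma> s) *\<^sub>R q s + (\<sigma> s + g) *\<^sub>R h s + (f s * \<sigma> s * \<kappa> s) *\<^sub>R a s"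
    by (simp add: q' h' algebra_simps)
  obtain l m where l: "velocity c' s = l *\<^sub>R q' s"
    and m: "velocity (velocity c') s = m *\<^sub>R q' s + l *\<^sub>R velocity q' s"
    by (rule developable_acceleration[OF assms(1) s assms(14,15,16)])
  have "(\<exists>k. velocity q' s = k *\<^sub>R a s) \<longleftrightarrow> \<sigma> s + g = f s * (f s * \<sigma> s)"
  proof (rule ruling_velocity_along_asymptotic_normal_iff)
    show "l *\<^sub>R q' s = q s + f s *\<^sub>R h s"
      using T[OF s] l by (simp add: f_def)
    show "m *\<^sub>R q' s + l *\<^sub>R velocity q' s =
        (f s * \<sigma> s) *\<^sub>R q s + (\<sigma> s + g) *\<^sub>R h s + (f s * \<sigma> s * \<kappa> s) *\<^sub>R a s"
      using acc m by simp
  qed (fact spacelike_surface_frame[OF assms(1) s assms(4,7,8)]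
      developable_velocity_along_ruling(1,2)[OF assms(1) s assms(14-16)])+
  also have "\<dots> \<longleftrightarrow> deriv \<kappa> s =
       1 / R * (R\<^sup>2 * (\<kappa> s)\<^sup>2 * (\<sigma> s)\<^sup>2 - 1) - 1 / \<sigma> s * deriv \<sigma> s * \<kappa> s"
    using \<sigma>_pos[OF s] assms(13) by (auto simp: f_def g_def field_simps power2_eq_square)
  finally show "(\<exists>k. velocity q' s = k *\<^sub>R a s) \<longleftrightarrow> deriv \<kappa> s =
       1 / R * (R\<^sup>2 * (\<kappa> s)\<^sup>2 * (deriv s1 s)\<^sup>2 - 1)
       - 1 / deriv s1 s * deriv (deriv s1) s * \<kappa> s"
    by (simp only: \<sigma>_def)
qed

end
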